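(* Let $N\ge 2$ and $m\ge 1$ be integers and let $x^{(r,s)}_k$ ($1\le r,s\le N$, $1\le k\le m$) be elements of a commutative ring; set $x^{(r,s)}_{m+1}=0$ for all $1\le r,s\le N$. Let $E(N,m)$ be the $Nm\times Nm$ matrix which, as an $N\times N$ block matrix with $m\times m$ blocks, has $(r,s)$ block $C_m(x^{(r,s)}_1,\dots,x^{(r,s)}_m)$ if $r$ is even and $A_m(x^{(r,s)}_1,\dots,x^{(r,s)}_m)$ if $r$ is odd. Then $$\det(E(N,m))=\begin{cases}(-1)^{\frac{Nm}{4}}\prod_{i=1}^{m}\det(X_{(i,i+1)}), & N \text{ even},\ m \text{ even},\\[2pt] (-1)^{\frac{N(m-1)}{4}}\prod_{i=1}^{m}\det(X_{(i,i+1)}), & N \text{ even},\ m \text{ odd},\\[2pt] (-1)^{\frac{(N-1)m}{4}}\prod_{i=1}^{m}\det(X_{(i,i+1)}), & N \text{ odd},\ m \text{ even},\\[2pt] (-1)^{\frac{(N-1)(m-1)}{4}}\prod_{i=1}^{m}\det(X_{(i,i+1)}), & N \text{ odd},\ m \text{ odd}.\end{cases}$$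
   Context: For elements $x_1,\dots,x_m$: $A_m(x_1,\dots,x_m)$ is the $m\times m$ matrix with $(p,q)$ entry $x_{m+1-\min(p,q)}$, and $C_m(x_1,\dots,x_m)$ is the $m\times m$ matrix with $(p,q)$ entry $x_{\max(p,\,m+1-q)}$. For $1\le i\le m$, $X_{(i,i+1)}$ is the $N\times N$ matrix whose $(r,s)$ entry is $x^{(r,s)}_i-x^{(r,s)}_{i+1}$. *)

theory Defs
  imports "Jordan_Normal_Form.Determinant"
begin

text \<open>The library numbers rows and columns of a matrix from 0, whereas all indices in the source
  (matrix positions \<open>p, q\<close>, blocks \<open>r, s\<close>, subscripts \<open>k\<close>) start at 1.  Families of ring elements
  keep the 1-based indices, and the position \<open>(p, q)\<close> of a matrix is stored at \<open>(p - 1, q - 1)\<close>.\<close>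

definition mat1 :: "nat \<Rightarrow> (nat \<Rightarrow> nat \<Rightarrow> 'a) \<Rightarrow> 'a mat" where
  "mat1 n f = mat n n (\<lambda>(i, j). f (i + 1) (j + 1))"

definition A_mat :: "nat \<Rightarrow> (nat \<Rightarrow> 'a) \<Rightarrow> 'a mat" where
  "A_mat m v = mat1 m (\<lambda>p q. v (m + 1 - min p q))"

definition C_mat :: "nat \<Rightarrow> (nat \<Rightarrow> 'a) \<Rightarrow> 'a mat" where
  "C_mat m v = mat1 m (\<lambda>p q. v (max p (m + 1 - q)))"

text \<open>The ring element \<open>x\<^sup>(\<^sup>r\<^sup>,\<^sup>s\<^sup>)\<^sub>k\<close> is \<open>x r s k\<close>.\<close>

definition X_mat :: "nat \<Rightarrow> (nat \<Rightarrow> nat \<Rightarrow> nat \<Rightarrow> 'a :: comm_ring_1) \<Rightarrow> nat \<Rightarrow> 'a mat" where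
  "X_mat N x i = mat1 N (\<lambda>r s. x r s i - x r s (i + 1))"

text \<open>The \<open>Nm \<times> Nm\<close> matrix whose \<open>(r, s)\<close> block (for \<open>1 \<le> r, s \<le> N\<close>) is the \<open>m \<times> m\<close> matrix \<open>B r s\<close>.\<close>

definition block_mat :: "nat \<Rightarrow> nat \<Rightarrow> (nat \<Rightarrow> nat \<Rightarrow> 'a mat) \<Rightarrow> 'a mat" where
  "block_mat N m B =
     mat (N * m) (N * m) (\<lambda>(i, j). B (i div m + 1) (j div m + 1) $$ (i mod m, j mod m))"

definition E_mat :: "nat \<Rightarrow> nat \<Rightarrow> (nat \<Rightarrow> nat \<Rightarrow> nat \<Rightarrow> 'a) \<Rightarrow> 'a mat" where
  "E_mat N m x =
     block_mat N m (\<lambda>r s. if even r then C_mat m (x r s) else A_mat m (x r s))"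

end

theory Submission
  imports Defs
begin

text \<open>Put \<open>d\<^sub>k = x\<^sub>k - x\<^sub>k\<^sub>+\<^sub>1\<close>.  Since \<open>x\<^sub>m\<^sub>+\<^sub>1 = 0\<close>, each entry \<open>x\<^sub>k\<close> of a block is the tail sum of the
  \<open>d\<^sub>l\<close> over \<open>l \<ge> k\<close>, so every block factors as \<open>P * D * Q\<close> with \<open>D\<close> the diagonal matrix of
  \<open>d\<^sub>m, \<dots>, d\<^sub>1\<close>, with \<open>Q\<close> upper unitriangular, and with \<open>P\<close> lower unitriangular (\<open>A\<^sub>m\<close>) or
  anti-triangular with unit entries (\<open>C\<^sub>m\<close>).  The outer factors depend only on the block row, so
  \<open>E\<close> is a product of three block matrices, the outer two being block diagonal: they
  contribute the sign \<open>(-1)\<close> to the power \<open>m (m - 1) / 2\<close> for each even \<open>r\<close>.  Exchanging the roles of the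
  block index and the inner index turns the middle factor into the block diagonal matrix of the
  \<open>X_mat N x k\<close>.\<close>

section \<open>Block matrices and their products\<close>

abbreviation block_diag :: "nat \<Rightarrow> nat \<Rightarrow> (nat \<Rightarrow> 'a mat) \<Rightarrow> 'a :: comm_ring_1 mat" where
  "block_diag N m P \<equiv> block_mat N m (\<lambda>r s. if r = s then P r else 0\<^sub>m m m)"

lemma block_mat_carrier [simp]: "block_mat N m B \<in> carrier_mat (N * m) (N * m)"
  by (simp add: block_mat_def)

lemma div_mod_less:
  fixes i m N :: nat
  assumes "i < N * m"
  shows "i div m < N" "i mod m < m"
proof -
  have "m > 0" using assms by (cases m) auto
  then show "i div m < N" "i mod m < m"
    using assms by (auto simp: less_mult_imp_div_less)
qed

lemma block_mat_cong:
  assumes "\<And>r s i j. r \<in> {1..N} \<Longrightarrow> s \<in> {1..N} \<Longrightarrow> i < m \<Longrightarrow> j < m \<Longrightarrow>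
    B r s $$ (i, j) = B' r s $$ (i, j)"
  shows "block_mat N m B = block_mat N m B'"
  unfolding block_mat_def
  by (intro cong_mat refl) (auto simp: div_mod_less Suc_leI intro!: assms)

lemma sum_block:
  fixes f :: "nat \<Rightarrow> 'a :: comm_monoid_add"
  shows "(\<Sum>k<N * m. f k) = (\<Sum>t = 1..N. \<Sum>k<m. f ((t - 1) * m + k))"
proof -
  have "(\<Sum>k<N * m. f k) = (\<Sum>t<N. sum f {t * m..<t * m + m})"
    by (simp add: sum.nat_group)
  also have "\<dots> = (\<Sum>t<N. \<Sum>k<m. f (t * m + k))"
  proof (rule sum.cong[OF refl])
    fix t
    show "sum f {t * m..<t * m + m} = (\<Sum>k<m. f (t * m + k))"
      using sum.shift_bounds_nat_ivl[of f 0 "t * m" m]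
      by (simp add: lessThan_atLeast0 add.commute)
  qed
  also have "\<dots> = (\<Sum>t = 1..N. \<Sum>k<m. f ((t - 1) * m + k))"
    by (rule sum.reindex_bij_witness[of _ "\<lambda>t. t - 1" Suc]) auto
  finally show ?thesis .
qed

text \<open>The blocks of the product are given entry by entry, which avoids a matrix-valued sum
  over \<open>t\<close>.\<close>

lemma block_mat_mult:
  fixes A B :: "nat \<Rightarrow> nat \<Rightarrow> 'a :: comm_ring_1 mat"
  shows "block_mat N m A * block_mat N m B =
    block_mat N m (\<lambda>r s. mat m m (\<lambda>(i, j). \<Sum>t = 1..N. \<Sum>k<m. A r t $$ (i, k) * B t s $$ (k, j)))"
    (is "?L = ?R")
proof (rule eq_matI)
  fix i j assume "i < dim_row ?R" "j < dim_col ?R"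
  then have ij: "i < N * m" "j < N * m" by (auto simp: block_mat_def)
  have "?L $$ (i, j) = (\<Sum>k<N * m. A (i div m + 1) (k div m + 1) $$ (i mod m, k mod m) *
      B (k div m + 1) (j div m + 1) $$ (k mod m, j mod m))"
    using ij by (simp add: block_mat_def scalar_prod_def lessThan_atLeast0)
  also have "\<dots> = ?R $$ (i, j)"
    using ij by (auto simp: sum_block block_mat_def div_mod_less intro!: sum.cong)
  finally show "?L $$ (i, j) = ?R $$ (i, j)" .
qed (auto simp: block_mat_def)

text \<open>With its right-hand counterpart, this pulls out of all blocks a factor that depends only
  on the block row (respectively the block column).\<close>

lemma block_diag_mult_left:
  assumes "\<And>r. r \<in> {1..N} \<Longrightarrow> P r \<in> carrier_mat m m"
    and "\<And>r s. r \<in> {1..N} \<Longrightarrow> s \<in> {1..N} \<Longrightarrow> B r s \<in> carrier_mat m m"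
  shows "block_diag N m P * block_mat N m B = block_mat N m (\<lambda>r s. P r * B r s)"
  unfolding block_mat_mult
proof (rule block_mat_cong)
  fix r s i j assume rs: "r \<in> {1..N}" "s \<in> {1..N}" and ij: "i < m" "j < m"
  have "(\<Sum>t = 1..N. \<Sum>k<m. (if r = t then P r else 0\<^sub>m m m) $$ (i, k) * B t s $$ (k, j)) =
      (\<Sum>t = 1..N. if r = t then \<Sum>k<m. P r $$ (i, k) * B r s $$ (k, j) else 0)"
    using ij by (intro sum.cong refl) auto
  also have "\<dots> = (P r * B r s) $$ (i, j)"
    using rs ij assms(1)[of r] assms(2)[of r s]
    by (simp add: scalar_prod_def lessThan_atLeast0)
  finally show "mat m m (\<lambda>(i, j). \<Sum>t = 1..N. \<Sum>k<m.
      (if r = t then P r else 0\<^sub>m m m) $$ (i, k) * B t s $$ (k, j)) $$ (i, j) = (P r * B r s) $$ (i, j)"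
    using ij by simp
qed

lemma block_diag_mult_right:
  assumes "\<And>r. r \<in> {1..N} \<Longrightarrow> P r \<in> carrier_mat m m"
    and "\<And>r s. r \<in> {1..N} \<Longrightarrow> s \<in> {1..N} \<Longrightarrow> B r s \<in> carrier_mat m m"
  shows "block_mat N m B * block_diag N m P = block_mat N m (\<lambda>r s. B r s * P s)"
  unfolding block_mat_mult
proof (rule block_mat_cong)
  fix r s i j assume rs: "r \<in> {1..N}" "s \<in> {1..N}" and ij: "i < m" "j < m"
  have "(\<Sum>t = 1..N. \<Sum>k<m. B r t $$ (i, k) * (if t = s then P t else 0\<^sub>m m m) $$ (k, j)) =
      (\<Sum>t = 1..N. if t = s then \<Sum>k<m. B r s $$ (i, k) * P s $$ (k, j) else 0)"
    using ij by (intro sum.cong refl) auto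
  also have "\<dots> = (B r s * P s) $$ (i, j)"
    using rs ij assms(1)[of s] assms(2)[of r s]
    by (simp add: scalar_prod_def lessThan_atLeast0)
  finally show "mat m m (\<lambda>(i, j). \<Sum>t = 1..N. \<Sum>k<m.
      B r t $$ (i, k) * (if t = s then P t else 0\<^sub>m m m) $$ (k, j)) $$ (i, j) = (B r s * P s) $$ (i, j)"
    using ij by simp
qed

section \<open>Determinants of block diagonal matrices over a commutative ring\<close>

text \<open>The identity block grows by one \<open>1 x 1\<close> corner at a time, and each step is
  an expansion along the last column. Together with the mirror image below, this handles the two
  factors in diag(A, B) = diag(A, 1) * diag(1, B).\<close>

lemma det_four_block_one_lower_right:
  fixes A :: "'a :: comm_ring_1 mat"
  assumes A: "A \<in> carrier_mat n n"
  shows "det (four_block_mat A (0\<^sub>m n m) (0\<^sub>m m n) (1\<^sub>m m)) = det A"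
proof (induction m)
  case 0
  have "four_block_mat A (0\<^sub>m n 0) (0\<^sub>m 0 n) (1\<^sub>m 0) = A"
    using A by (intro eq_matI) auto
  then show ?case by simp
next
  case (Suc m)
  let ?B = "four_block_mat A (0\<^sub>m n m) (0\<^sub>m m n) (1\<^sub>m m)"
  have "four_block_mat A (0\<^sub>m n (Suc m)) (0\<^sub>m (Suc m) n) (1\<^sub>m (Suc m)) =
      four_block_mat ?B (0\<^sub>m (n + m) 1) (0\<^sub>m 1 (n + m)) (1\<^sub>m 1)"
    using A by (intro eq_matI) auto
  also have "det \<dots> = det ?B * det (1\<^sub>m 1 :: 'a mat)"
    using A by (intro det_four_block_mat_upper_right_zero_col[of _ "n + m"]) auto
  finally show ?case using Suc by simp
qed

lemma det_four_block_one_upper_left: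
  fixes B :: "'a :: comm_ring_1 mat"
  assumes B: "B \<in> carrier_mat m m"
  shows "det (four_block_mat (1\<^sub>m n) (0\<^sub>m n m) (0\<^sub>m m n) B) = det B"
proof (induction n)
  case 0
  have "four_block_mat (1\<^sub>m 0) (0\<^sub>m 0 m) (0\<^sub>m m 0) B = B"
    using B by (intro eq_matI) auto
  then show ?case by simp
next
  case (Suc n)
  let ?B = "four_block_mat (1\<^sub>m n) (0\<^sub>m n m) (0\<^sub>m m n) B"
  have "four_block_mat (1\<^sub>m (Suc n)) (0\<^sub>m (Suc n) m) (0\<^sub>m m (Suc n)) B =
      four_block_mat (1\<^sub>m 1) (0\<^sub>m 1 (n + m)) (0\<^sub>m (n + m) 1) ?B"
    using B by (intro eq_matI) auto
  also have "det \<dots> = det (1\<^sub>m 1 :: 'a mat) * det ?B"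
    using B by (intro det_four_block_mat_lower_left_zero_col[of _ _ "n + m"]) auto
  finally show ?case using Suc by simp
qed

text \<open>The library's \<open>det_four_block_mat_upper_right_zero\<close> requires an integral domain.\<close>

lemma det_four_block_diag:
  fixes A B :: "'a :: comm_ring_1 mat"
  assumes A: "A \<in> carrier_mat n n" and B: "B \<in> carrier_mat m m"
  shows "det (four_block_mat A (0\<^sub>m n m) (0\<^sub>m m n) B) = det A * det B"
proof -
  let ?A' = "four_block_mat A (0\<^sub>m n m) (0\<^sub>m m n) (1\<^sub>m m)"
  let ?B' = "four_block_mat (1\<^sub>m n) (0\<^sub>m n m) (0\<^sub>m m n) B"
  have "four_block_mat A (0\<^sub>m n m) (0\<^sub>m m n) B = ?A' * ?B'"
    using A B by (subst mult_four_block_mat[of _ n n _ m _ m _ _ n _ m]) auto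
  also have "det \<dots> = det ?A' * det ?B'"
    using A B by (intro det_mult[of _ "n + m"]) auto
  finally show ?thesis
    by (simp add: det_four_block_one_lower_right[OF A] det_four_block_one_upper_left[OF B])
qed

lemma det_block_diag:
  fixes P :: "nat \<Rightarrow> 'a :: comm_ring_1 mat"
  assumes "\<And>r. r \<in> {1..N} \<Longrightarrow> P r \<in> carrier_mat m m"
  shows "det (block_diag N m P) = (\<Prod>r = 1..N. det (P r))"
  using assms
proof (induction N)
  case 0
  then show ?case by (simp add: block_mat_def)
next
  case (Suc N)
  have P: "P (Suc N) \<in> carrier_mat m m" by (simp add: Suc.prems)
  have "block_diag (Suc N) m P =
      four_block_mat (block_diag N m P) (0\<^sub>m (N * m) m) (0\<^sub>m m (N * m)) (P (Suc N))" (is "?L = ?R")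
  proof (rule eq_matI)
    fix i j assume "i < dim_row ?R" "j < dim_col ?R"
    then have ij: "i < Suc N * m" "j < Suc N * m" using P by (auto simp: block_mat_def)
    \<comment> \<open>Indices from \<open>N * m\<close> on lie in the last block, which has number
      \<open>N\<close> when counted from 0.\<close>
    have last: "k div m = N \<and> k mod m = k - N * m" if "k < Suc N * m" "\<not> k < N * m" for k
    proof -
      have "m > 0" using that by (cases m) auto
      moreover have "k = N * m + (k - N * m)" "k - N * m < m" using that by auto
      ultimately show ?thesis
        by (metis add.commute div_mult_self3 div_less add_0_right mod_less mod_mult_self3 less_not_refl2)
    qed
    show "?L $$ (i, j) = ?R $$ (i, j)"
      using ij P last[of i] last[of j] div_mod_less[of i N m] div_mod_less[of j N m]
        div_mod_less[of i "Suc N" m] div_mod_less[of j "Suc N" m]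
      by (cases "i < N * m"; cases "j < N * m") (simp_all add: block_mat_def)
  qed (use P in \<open>auto simp: block_mat_def\<close>)
  then show ?case
    using Suc by (simp add: det_four_block_diag[OF block_mat_carrier P])
qed

section \<open>Exchanging the block index and the inner index\<close>

text \<open>The sign of \<open>p\<close> enters once for the rows and once for the columns, and its
  square is 1.\<close>

lemma det_permute_rows_cols:
  fixes A :: "'a :: comm_ring_1 mat"
  assumes A: "A \<in> carrier_mat n n" and p: "p permutes {0..<n}"
  shows "det (mat n n (\<lambda>(i, j). A $$ (p i, p j))) = det A"
proof -
  let ?B = "mat n n (\<lambda>(i, j). A\<^sup>T $$ (p i, j))"
  have pl: "p i < n" if "i < n" for i
    using permutes_in_image[OF p, of i] that by simp
  \<comment> \<open>The column permutation is expressed as a row permutation between two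
    transpositions.\<close>
  have "mat n n (\<lambda>(i, j). A $$ (p i, p j)) = mat n n (\<lambda>(i, j). ?B\<^sup>T $$ (p i, j))"
    using A pl by (intro cong_mat) auto
  also have "det \<dots> = signof p * det (?B\<^sup>T)"
    by (rule det_permute_rows[OF _ p]) auto
  also have "det (?B\<^sup>T) = det ?B"
    by (rule det_transpose) auto
  also have "det ?B = signof p * det (A\<^sup>T)"
    using A by (intro det_permute_rows[OF _ p]) auto
  also have "det (A\<^sup>T) = det A"
    by (rule det_transpose[OF A])
  finally show ?thesis
    by (simp add: sign_def)
qed

text \<open>This is the perfect shuffle: the pair (\<open>i div N\<close>, \<open>i mod N\<close>)
  is swapped and re-encoded with block size \<open>m\<close>. The inverse is the same formula with
  \<open>N\<close> and \<open>m\<close> exchanged, so \<open>bound\<close> and \<open>inv\<close>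
  are stated for all \<open>N\<close> and \<open>m\<close> and used in both directions.\<close>

lemma shuffle_bij:
  "bij_betw (\<lambda>i. (i mod N) * m + i div N) {0..<N * m} {0..<N * m :: nat}"
proof (rule bij_betw_byWitness[where f' = "\<lambda>i. (i mod m) * N + i div m"])
  have bound: "(i mod N) * m + i div N < N * m" if "i < N * m" for i N m :: nat
  proof -
    have "i mod N < N" "i div N < m" using div_mod_less[of i m N] that by (auto simp: mult.commute)
    then have "(i mod N) * m + i div N < (i mod N + 1) * m" by simp
    also have "\<dots> \<le> N * m" using \<open>i mod N < N\<close> by (intro mult_right_mono) auto
    finally show ?thesis .
  qed
  have inv: "((i mod N) * m + i div N) mod m * N + ((i mod N) * m + i div N) div m = i"
    if "i < N * m" for i N m :: nat
    using div_mod_less[of i m N] that by (simp add: mult.commute)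
  show "\<forall>i\<in>{0..<N * m}. ((i mod N) * m + i div N) mod m * N + ((i mod N) * m + i div N) div m = i"
    using inv by auto
  show "\<forall>i\<in>{0..<N * m}. ((i mod m) * N + i div m) mod N * m + ((i mod m) * N + i div m) div N = i"
    using inv[of _ m N] by (auto simp: mult.commute)
  show "(\<lambda>i. (i mod N) * m + i div N) ` {0..<N * m} \<subseteq> {0..<N * m}"
    using bound by auto
  show "(\<lambda>i. (i mod m) * N + i div m) ` {0..<N * m} \<subseteq> {0..<N * m}"
    using bound[of _ m N] by (auto simp: mult.commute)
qed

lemma det_block_mat_shuffle:
  fixes B C :: "nat \<Rightarrow> nat \<Rightarrow> 'a :: comm_ring_1 mat"
  assumes BC: "\<And>r s k l. r < N \<Longrightarrow> s < N \<Longrightarrow> k < m \<Longrightarrow> l < m \<Longrightarrow>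
    B (r + 1) (s + 1) $$ (k, l) = C (k + 1) (l + 1) $$ (r, s)"
  shows "det (block_mat N m B) = det (block_mat m N C)"
proof -
  \<comment> \<open>The shuffle is extended by the identity, since \<open>permutes\<close> demands
    fixed points outside the index range.\<close>
  define p where "p i = (if i < N * m then (i mod N) * m + i div N else i)" for i
  have "bij_betw p {0..<N * m} {0..<N * m}"
    using shuffle_bij[of N m] by (rule bij_betw_cong[THEN iffD1, rotated]) (auto simp: p_def)
  then have p: "p permutes {0..<N * m}"
    by (rule bij_imp_permutes) (auto simp: p_def)
  have "mat (N * m) (N * m) (\<lambda>(i, j). block_mat N m B $$ (p i, p j)) = block_mat m N C"
  proof (rule eq_matI)
    fix i j assume "i < dim_row (block_mat m N C)" "j < dim_col (block_mat m N C)"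
    then have ij: "i < N * m" "j < N * m" by (auto simp: block_mat_def mult.commute)
    have "p i < N * m" "p j < N * m" using permutes_in_image[OF p] ij by auto
    moreover have "i < m * N" "j < m * N" using ij by (auto simp: mult.commute)
    ultimately show "mat (N * m) (N * m) (\<lambda>(i, j). block_mat N m B $$ (p i, p j)) $$ (i, j) = block_mat m N C $$ (i, j)"
      using ij div_mod_less[of i m N] div_mod_less[of j m N]
        BC[of "i mod N" "j mod N" "i div N" "j div N"]
      \<comment> \<open>\<open>p\<close> stays folded in the first call so that the bounds on
        \<open>p i\<close> and \<open>p j\<close> can be applied.\<close>
      by (simp add: block_mat_def) (simp add: p_def)
  qed (auto simp: block_mat_def mult.commute)
  then show ?thesis
    using det_permute_rows_cols[OF block_mat_carrier p, of B] by simp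
qed

section \<open>Factorisation of a single block\<close>

text \<open>After transposition the last column has a single 1, at the top. Expanding along it gives
  the sign \<open>(-1) ^ m\<close> and the same matrix of size \<open>m\<close>, so the exponents
  add up to 0 + 1 + ... + (m - 1).\<close>

lemma det_anti_triangular_ones:
  "det (mat m m (\<lambda>(i, k). if k + i < m then 1 else 0) :: 'a :: comm_ring_1 mat) = (-1) ^ (m * (m - 1) div 2)"
proof (induction m)
  case 0
  then show ?case by simp
next
  case (Suc m)
  let ?R = "\<lambda>m. mat m m (\<lambda>(i, k). if k + i < m then 1 else 0) :: 'a mat"
  have "det (?R (Suc m)) = det ((?R (Suc m))\<^sup>T)"
    by (rule det_transpose[symmetric, of _ "Suc m"]) simp
  also have "(?R (Suc m))\<^sup>T = four_block_mat (mat 1 m (\<lambda>_. 1)) (1\<^sub>m 1) ((?R m)\<^sup>T) (0\<^sub>m m 1)"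
    by (intro eq_matI) auto
  also have "det \<dots> = (-1) ^ m * det (?R m)"
    by (subst det_four_block_mat_lower_right_zero_col[of _ m]) (auto simp: det_transpose[of _ m])
  also have "\<dots> = (-1) ^ (m + m * (m - 1) div 2)"
    by (simp add: Suc power_add)
  also have "m + m * (m - 1) div 2 = Suc m * (Suc m - 1) div 2"
    by (cases m) auto
  finally show ?case .
qed

text \<open>The indices run downwards because the diagonal of \<open>D\<close> starts with the
  difference at \<open>m\<close>. Once \<open>v (m + 1) = 0\<close>, the sum is the single element
  \<open>v (Suc m - n)\<close>.\<close>

lemma sum_diff_telescope:
  fixes v :: "nat \<Rightarrow> 'a :: comm_ring_1"
  assumes "n \<le> m"
  shows "(\<Sum>k<n. v (m - k) - v (Suc m - k)) = v (Suc m - n) - v (Suc m)"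
  using sum_lessThan_telescope[of "\<lambda>k. v (Suc m - k)" n] by simp

text \<open>Entry \<open>(i, j)\<close> of the product sums the differences over those
  \<open>k\<close> that both outer factors admit. For either row pattern these \<open>k\<close> form
  an initial segment, so the sum telescopes to one element of \<open>v\<close>.\<close>

lemma A_C_factorisation:
  fixes v :: "nat \<Rightarrow> 'a :: comm_ring_1"
  assumes v: "v (m + 1) = 0"
  defines "D \<equiv> mat m m (\<lambda>(k, l). if k = l then v (m - k) - v (Suc m - k) else 0)"
    and "Q \<equiv> mat m m (\<lambda>(k, j). if k \<le> j then 1 else 0)"
  shows "A_mat m v = mat m m (\<lambda>(i, k). if k \<le> i then 1 else 0) * D * Q"
    and "C_mat m v = mat m m (\<lambda>(i, k). if k + i < m then 1 else 0) * D * Q"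
proof -
  \<comment> \<open>The row pattern \<open>p\<close> is left arbitrary so that one computation
    serves both claims.\<close>
  have entry: "(mat m m (\<lambda>(i, k). if p i k then 1 else 0) * D * Q) $$ (i, j) =
      (\<Sum>k\<in>{k. k < m \<and> p i k \<and> k \<le> j}. v (m - k) - v (Suc m - k))"
    if ij: "i < m" "j < m" for p i j
  proof -
    have "(mat m m (\<lambda>(i, k). if p i k then 1 else 0) * D * Q) $$ (i, j) =
       (\<Sum>l<m. (\<Sum>k<m. (if p i k then 1 else 0) * (if k = l then v (m - k) - v (Suc m - k) else 0)) *
          (if l \<le> j then 1 else 0))"
      using ij by (simp add: D_def Q_def scalar_prod_def lessThan_atLeast0)
    also have "\<dots> = (\<Sum>l<m. if p i l \<and> l \<le> j then v (m - l) - v (Suc m - l) else 0)"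
    proof (intro sum.cong refl)
      fix l assume "l \<in> {..<m}"
      have "(\<Sum>k<m. (if p i k then 1 else 0) * (if k = l then v (m - k) - v (Suc m - k) else 0)) =
          (\<Sum>k<m. if k = l then (if p i l then 1 else 0) * (v (m - l) - v (Suc m - l)) else 0)"
        by (intro sum.cong refl) simp
      then show "(\<Sum>k<m. (if p i k then 1 else 0) * (if k = l then v (m - k) - v (Suc m - k) else 0)) *
          (if l \<le> j then 1 else 0) = (if p i l \<and> l \<le> j then v (m - l) - v (Suc m - l) else 0)"
        using \<open>l \<in> {..<m}\<close> by simp
    qed
    also have "\<dots> = (\<Sum>k\<in>{k\<in>{..<m}. p i k \<and> k \<le> j}. v (m - k) - v (Suc m - k))"
      by (rule sum.inter_filter[symmetric]) simp
    finally show ?thesis by simp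
  qed
  show "A_mat m v = mat m m (\<lambda>(i, k). if k \<le> i then 1 else 0) * D * Q" (is "_ = ?L * D * Q")
  proof (rule eq_matI)
    fix i j assume "i < dim_row (?L * D * Q)" "j < dim_col (?L * D * Q)"
    then have ij: "i < m" "j < m" by (simp_all add: Q_def)
    have "{k. k < m \<and> k \<le> i \<and> k \<le> j} = {..<Suc (min i j)}" using ij by auto
    then show "A_mat m v $$ (i, j) = (?L * D * Q) $$ (i, j)"
      using ij v sum_diff_telescope[of "Suc (min i j)" m v]
      by (simp only: entry) (simp add: A_mat_def mat1_def)
  qed (auto simp: A_mat_def mat1_def Q_def)
  show "C_mat m v = mat m m (\<lambda>(i, k). if k + i < m then 1 else 0) * D * Q" (is "_ = ?L * D * Q")
  proof (rule eq_matI)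
    fix i j assume "i < dim_row (?L * D * Q)" "j < dim_col (?L * D * Q)"
    then have ij: "i < m" "j < m" by (simp_all add: Q_def)
    have "{k. k < m \<and> k + i < m \<and> k \<le> j} = {..<min (m - i) (Suc j)}" using ij by auto
    \<comment> \<open>This turns the segment length into the 1-based subscript of
      \<open>C_mat\<close>: \<open>p = Suc i\<close> and \<open>m + 1 - q = m - j\<close>.\<close>
    moreover have "Suc m - min (m - i) (Suc j) = max (Suc i) (m - j)" using ij by auto
    ultimately show "C_mat m v $$ (i, j) = (?L * D * Q) $$ (i, j)"
      using ij v sum_diff_telescope[of "min (m - i) (Suc j)" m v]
      by (simp only: entry) (simp add: C_mat_def mat1_def)
  qed (auto simp: C_mat_def mat1_def Q_def)
qed

section \<open>The determinant of \<open>E_mat\<close> and its sign\<close>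

lemma prod_if_even:
  fixes c :: "'a :: comm_monoid_mult"
  shows "(\<Prod>r = 1..N. if even r then c else 1) = c ^ (N div 2)"
  by (induction N) (auto simp: mult.commute elim!: evenE oddE)

text \<open>One formula covers all parities of \<open>N\<close> and \<open>m\<close>; the four cases
  of the theorem only rewrite its exponent.\<close>

lemma det_E_mat:
  fixes x :: "nat \<Rightarrow> nat \<Rightarrow> nat \<Rightarrow> 'a :: comm_ring_1"
  assumes x: "\<And>r s. r \<in> {1..N} \<Longrightarrow> s \<in> {1..N} \<Longrightarrow> x r s (m + 1) = 0"
  shows "det (E_mat N m x) =
    (-1) ^ (m * (m - 1) div 2 * (N div 2)) * (\<Prod>i = 1..m. det (X_mat N x i))"
proof -
  define L R Q :: "'a mat" where
    "L = mat m m (\<lambda>(i, k). if k \<le> i then 1 else 0)" and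
    "R = mat m m (\<lambda>(i, k). if k + i < m then 1 else 0)" and
    "Q = mat m m (\<lambda>(k, j). if k \<le> j then 1 else 0)"
  define P where "P r = (if even r then R else L)" for r :: nat
  define D where "D r s = mat m m (\<lambda>(k, l). if k = l then x r s (m - k) - x r s (Suc m - k) else 0)"
    for r s
  have carrier: "L \<in> carrier_mat m m" "R \<in> carrier_mat m m" "Q \<in> carrier_mat m m"
    "P r \<in> carrier_mat m m" "D r s \<in> carrier_mat m m" for r s
    by (auto simp: L_def R_def Q_def P_def D_def)
  have "det L = 1"
    by (subst det_lower_triangular[of m])
      (auto simp: L_def prod_list_diag_prod intro!: prod.neutral)
  moreover have "det Q = 1"
    by (subst det_upper_triangular[of _ m])
      (auto simp: Q_def prod_list_diag_prod upper_triangular_def intro!: prod.neutral)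
  moreover have "det R = (-1) ^ (m * (m - 1) div 2)"
    unfolding R_def by (rule det_anti_triangular_ones)
  ultimately have dets: "det Q = 1"
    "det (P r) = (if even r then (-1) ^ (m * (m - 1) div 2) else 1)" for r
    by (auto simp: P_def)
  have "E_mat N m x = block_mat N m (\<lambda>r s. P r * D r s * Q)"
    unfolding E_mat_def
  proof (rule block_mat_cong)
    fix r s i j assume "r \<in> {1..N}" "s \<in> {1..N}"
    then have "(if even r then C_mat m (x r s) else A_mat m (x r s)) = P r * D r s * Q"
      using A_C_factorisation[where v = "x r s", OF x] by (simp add: P_def D_def L_def R_def Q_def)
    then show "(if even r then C_mat m (x r s) else A_mat m (x r s)) $$ (i, j) = (P r * D r s * Q) $$ (i, j)"
      by simp
  qed
  also have "\<dots> = block_mat N m (\<lambda>r s. P r * D r s) * block_diag N m (\<lambda>_. Q)"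
    by (rule block_diag_mult_right[symmetric]) (rule carrier mult_carrier_mat)+
  finally have E: "E_mat N m x = block_mat N m (\<lambda>r s. P r * D r s) * block_diag N m (\<lambda>_. Q)" .
  have PD: "block_mat N m (\<lambda>r s. P r * D r s) = block_diag N m P * block_mat N m D"
    by (rule block_diag_mult_left[symmetric]) (rule carrier)+
  have "det (E_mat N m x) = det (block_diag N m P) * det (block_mat N m D) * det (block_diag N m (\<lambda>_. Q))"
    unfolding E det_mult[OF block_mat_carrier block_mat_carrier]
    unfolding PD det_mult[OF block_mat_carrier block_mat_carrier] ..
  moreover have "det (block_diag N m P) = (-1) ^ (m * (m - 1) div 2 * (N div 2))"
    by (simp only: det_block_diag[OF carrier(4)] dets prod_if_even power_mult)
  moreover have "det (block_diag N m (\<lambda>_. Q)) = 1"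
    using carrier by (simp add: det_block_diag dets)
  moreover have "det (block_mat N m D) = (\<Prod>i = 1..m. det (X_mat N x i))"
  proof -
    \<comment> \<open>Each block of \<open>D\<close> is diagonal, so after the exchange only
      diagonal blocks survive. They appear in reversed order, as diagonal position
      \<open>k - 1\<close> holds the difference at \<open>Suc m - k\<close>.\<close>
    have "det (block_mat N m D) = det (block_diag m N (\<lambda>k. X_mat N x (Suc m - k)))"
      by (rule det_block_mat_shuffle) (auto simp: D_def X_mat_def mat1_def Suc_diff_le)
    also have "\<dots> = (\<Prod>k = 1..m. det (X_mat N x (Suc m - k)))"
      by (rule det_block_diag) (auto simp: X_mat_def mat1_def)
    also have "\<dots> = (\<Prod>i = 1..m. det (X_mat N x i))"
      by (rule prod.reindex_bij_witness[of _ "\<lambda>k. Suc m - k" "\<lambda>k. Suc m - k"]) auto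
    finally show ?thesis .
  qed
  ultimately show ?thesis by simp
qed

lemma minus_one_power_cong:
  "even a = even b \<Longrightarrow> (-1) ^ a = ((-1) ^ b :: 'a :: ring_1)"
  by (simp add: minus_one_power_iff)

theorem theorem3p1:
  fixes N m :: nat
    and x :: "nat \<Rightarrow> nat \<Rightarrow> nat \<Rightarrow> 'a :: comm_ring_1"
  assumes "N \<ge> 2" and "m \<ge> 1"
    and "\<And>r s. r \<in> {1..N} \<Longrightarrow> s \<in> {1..N} \<Longrightarrow> x r s (m + 1) = 0"
  shows "det (E_mat N m x) =
    (if even N \<and> even m then
       (-1) ^ (N * m div 4) * (\<Prod>i = 1..m. det (X_mat N x i))
     else if even N \<and> odd m then
       (-1) ^ (N * (m - 1) div 4) * (\<Prod>i = 1..m. det (X_mat N x i))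
     else if odd N \<and> even m then
       (-1) ^ ((N - 1) * m div 4) * (\<Prod>i = 1..m. det (X_mat N x i))
     else
       (-1) ^ ((N - 1) * (m - 1) div 4) * (\<Prod>i = 1..m. det (X_mat N x i)))"
proof -
  let ?e = "m * (m - 1) div 2 * (N div 2)"
  have half: "(2 * a) * (2 * b) div 4 = a * b" for a b :: nat by simp
  have N: "even N \<Longrightarrow> N = 2 * (N div 2)" "odd N \<Longrightarrow> N - 1 = 2 * (N div 2)"
    and m: "even m \<Longrightarrow> m = 2 * (m div 2)" "odd m \<Longrightarrow> m - 1 = 2 * (m div 2)"
    by auto
  \<comment> \<open>All four divisions by 4 are exact, and the four exponents are the same product
    of halves.\<close>
  have quarter: "even N \<Longrightarrow> even m \<Longrightarrow> N * m div 4 = (N div 2) * (m div 2)"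
    "even N \<Longrightarrow> odd m \<Longrightarrow> N * (m - 1) div 4 = (N div 2) * (m div 2)"
    "odd N \<Longrightarrow> even m \<Longrightarrow> (N - 1) * m div 4 = (N div 2) * (m div 2)"
    "odd N \<Longrightarrow> odd m \<Longrightarrow> (N - 1) * (m - 1) div 4 = (N div 2) * (m div 2)"
    using N m half by metis+
  \<comment> \<open>For \<open>m = 2 * b\<close> the left number is \<open>b * (m - 1)\<close>, for
    \<open>m = 2 * b + 1\<close> it is \<open>m * b\<close>: in both cases
    \<open>b = m div 2\<close> times an odd number. The bound \<open>m \<ge> 1\<close> keeps the
    truncated \<open>m - 1\<close> odd when \<open>m\<close> is even.\<close>
  have "even (m * (m - 1) div 2) = even (m div 2)"
  proof (cases "even m")
    case True
    then obtain b where b: "m = 2 * b" by blast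
    then have "odd (m - 1)" using assms(2) by auto
    moreover have "m * (m - 1) div 2 = b * (m - 1)" by (simp add: b)
    ultimately show ?thesis by (simp add: b)
  next
    case False
    then obtain b where b: "m = 2 * b + 1" by (blast elim: oddE)
    then have "m * (m - 1) div 2 = m * b" by simp
    then show ?thesis using False b by simp
  qed
  then have "even ?e = even ((N div 2) * (m div 2))"
    by auto
  then have "(-1) ^ ?e = ((-1) ^ ((N div 2) * (m div 2)) :: 'a)"
    by (rule minus_one_power_cong)
  then have "det (E_mat N m x) = (-1) ^ ((N div 2) * (m div 2)) * (\<Prod>i = 1..m. det (X_mat N x i))"
    using det_E_mat[of N x m, OF assms(3)] by simp
  then show ?thesis
    using quarter by simp
qed

end
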